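(* Let $X_1,\dots,X_d$ be smooth vector fields defined on an open subset of $\mathbb{R}^n$. Consider the following iterative procedure: Step 1: Find the reduced row echelon form of the coefficient matrix of $X_1,\dots,X_d$ (row operations with smooth functions as coefficients, on an open set where the required pivots do not vanish), and let $Y_1,\dots,Y_r$ be the vector fields corresponding to its nonzero rows. If $[Y_i,Y_j]=0$ for all $i,j$, stop. Otherwise go to Step 2. Step 2: If some $[Y_i,Y_j]\neq 0$, set $Y_{r+1}:=[Y_i,Y_j]$, and return to Step 1 with the family $Y_1,\dots,Y_r,Y_{r+1}$ in place of $X_1,\dots,X_d$. Then this process terminates in at most $n$ iterations, and if $V_1,\dots,V_m$ are the (pairwise commuting) vector fields obtained at the end of the process, the (local) joint invariants of $X_1,\dots,X_d$ coincide with the (local) joint invariants of $V_1,\dots,V_m$.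
   Context: A vector field $\sum_{k=1}^n c_k\,\partial/\partial x_k$ is identified with its row of coefficient functions $(c_1,\dots,c_n)$, and a finite family of vector fields with the matrix whose rows are these coefficient rows (its coefficient matrix). A (local) joint invariant of a family of vector fields $Z_1,\dots,Z_m$ is a smooth function $f$ on some open subset with $Z_i(f)=0$ for all $i$. $[\cdot,\cdot]$ denotes the Lie bracket of vector fields. *)

theory Defs
  imports "HOL-Analysis.Analysis"
begin

primrec Ck_on :: "nat \<Rightarrow> 'a::real_normed_vector set \<Rightarrow> ('a \<Rightarrow> 'b::real_normed_vector) \<Rightarrow> bool" where
  "Ck_on 0 S f = continuous_on S f"
| "Ck_on (Suc k) S f =
     ((\<forall>x\<in>S. f differentiable (at x)) \<and>
      (\<forall>v. Ck_on k S (\<lambda>x. frechet_derivative f (at x) v)))"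

definition smooth_on :: "'a::real_normed_vector set \<Rightarrow> ('a \<Rightarrow> 'b::real_normed_vector) \<Rightarrow> bool" where
  "smooth_on S f \<longleftrightarrow> (\<forall>k. Ck_on k S f)"

text \<open>A vector field on (an open subset of) R^n, identified with its
  row of coefficient functions.\<close>
type_synonym 'n vf = "(real, 'n) vec \<Rightarrow> (real, 'n) vec"

definition vf_apply :: "'n::finite vf \<Rightarrow> ((real, 'n) vec \<Rightarrow> real) \<Rightarrow> (real, 'n) vec \<Rightarrow> real" where
  "vf_apply Z f x = frechet_derivative f (at x) (Z x)"

definition lie :: "'n::finite vf \<Rightarrow> 'n vf \<Rightarrow> 'n vf" where
  "lie X Y x = frechet_derivative Y (at x) (X x) - frechet_derivative X (at x) (Y x)"

definition joint_invariant :: "(real, 'n::finite) vec set \<Rightarrow> (nat \<Rightarrow> 'n vf) \<Rightarrow> nat \<Rightarrow> ((real, 'n) vec \<Rightarrow> real) \<Rightarrow> bool" where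
  "joint_invariant S Z m f \<longleftrightarrow>
     open S \<and> smooth_on S f \<and> (\<forall>i<m. \<forall>x\<in>S. vf_apply (Z i) f x = 0)"

definition rref_on :: "(real, 'n::{finite,wellorder}) vec set \<Rightarrow> (nat \<Rightarrow> 'n vf) \<Rightarrow> nat \<Rightarrow> bool" where
  "rref_on W Y r \<longleftrightarrow>
     (\<exists>p :: nat \<Rightarrow> 'n::{finite,wellorder}.
        (\<forall>i j. i < j \<longrightarrow> j < r \<longrightarrow> p i < p j) \<and>
        (\<forall>x\<in>W. \<forall>i<r.
            Y i x $ p i = 1 \<and>
            (\<forall>j<r. j \<noteq> i \<longrightarrow> Y j x $ p i = 0) \<and>
            (\<forall>k. k < p i \<longrightarrow> Y i x $ k = 0)))"

definition row_equiv_on :: "(real, 'n::finite) vec set \<Rightarrow> (nat \<Rightarrow> 'n vf) \<Rightarrow> nat \<Rightarrow> (nat \<Rightarrow> 'n vf) \<Rightarrow> nat \<Rightarrow> bool" where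
  "row_equiv_on W X d Y r \<longleftrightarrow>
     (\<exists>(A :: nat \<Rightarrow> nat \<Rightarrow> (real, 'n::finite) vec \<Rightarrow> real) (B :: nat \<Rightarrow> nat \<Rightarrow> (real, 'n) vec \<Rightarrow> real).
        (\<forall>i j. smooth_on W (A i j)) \<and> (\<forall>i j. smooth_on W (B i j)) \<and>
        (\<forall>x\<in>W. \<forall>i<r. Y i x = (\<Sum>j<d. A i j x *\<^sub>R X j x)) \<and>
        (\<forall>x\<in>W. \<forall>j<d. X j x = (\<Sum>i<r. B j i x *\<^sub>R Y i x)))"

text \<open>Step 1: starting from X_0..X_(d-1) on the open set W, pass to a nonempty
  open subset W' on which the row reduction is carried out (the pivots used are
  entries that do not vanish, so the number r of nonzero rows is the generic,
  i.e. maximal, rank of the coefficient matrix on W), obtaining Y_0..Y_(r-1).\<close>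
definition step1 :: "(nat \<Rightarrow> ('n::{finite,wellorder}) vf) \<Rightarrow> nat \<Rightarrow> ((real, 'n) vec) set \<Rightarrow>
                     (nat \<Rightarrow> 'n vf) \<Rightarrow> nat \<Rightarrow> ((real, 'n) vec) set \<Rightarrow> bool" where
  "step1 X d W Y r W' \<longleftrightarrow>
     open W' \<and> W' \<noteq> {} \<and> W' \<subseteq> W \<and>
     (\<forall>x\<in>W. dim {X j x | j. j < d} \<le> r) \<and>
     rref_on W' Y r \<and> row_equiv_on W' X d Y r"

definition commuting_on :: "(real, 'n::finite) vec set \<Rightarrow> (nat \<Rightarrow> 'n vf) \<Rightarrow> nat \<Rightarrow> bool" where
  "commuting_on W Y r \<longleftrightarrow> (\<forall>i<r. \<forall>j<r. \<forall>x\<in>W. lie (Y i) (Y j) x = 0)"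

text \<open>reach X d U k Z e W: starting from X_0..X_(d-1) on U, after k full
  iterations (Step 1 followed by Step 2) the process is about to perform Step 1
  with the family Z_0..Z_(e-1) on the open set W.\<close>
inductive reach :: "(nat \<Rightarrow> 'n vf) \<Rightarrow> nat \<Rightarrow> (real, 'n::{finite,wellorder}) vec set \<Rightarrow> nat \<Rightarrow>
                    (nat \<Rightarrow> 'n vf) \<Rightarrow> nat \<Rightarrow> ((real, 'n) vec) set \<Rightarrow> bool"
  for X d U where
  reach_0: "reach X d U 0 X d U"
| reach_Suc: "reach X d U k Z e W \<Longrightarrow> step1 Z e W Y r W' \<Longrightarrow> i < r \<Longrightarrow> j < r \<Longrightarrow>
     (\<exists>x\<in>W'. lie (Y i) (Y j) x \<noteq> 0) \<Longrightarrow>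
     reach X d U (Suc k) (Y(r := lie (Y i) (Y j))) (Suc r) W'"

end

(* If all Y_i annihilate f on an open set, differentiating Df(Y_i) = 0 and the symmetry of the second
   derivative of f show that [Y_i,Y_j] annihilates f, so no step changes the joint invariants.
   In reduced row echelon form the pivot entries are constant, hence [Y_i,Y_j] vanishes in the pivot
   columns; where it is nonzero it is independent of the Y_i, and the maximal rank increases.  As the
   rank is at most n, this bounds the number of iterations.
   A reduced row echelon form exists on some open set: among all rows obtained by smooth combination
   that carry an identity matrix in some pivot columns, on any nonempty open set, take a choice with
   the largest number of pivots and then with the pivots as far to the left as possible. *)
theory Submission
  imports Defs
begin

subsection \<open>Smooth functions\<close>

text \<open>\<open>frechet_derivative\<close> is a choice among all derivatives, so functions with
  the same derivatives at \<open>x\<close> yield the same choice, whether or not a derivative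
  exists.\<close>

lemma frechet_derivative_cong_open:
  assumes "open S" "x \<in> S" "\<And>y. y \<in> S \<Longrightarrow> f y = g y"
  shows "frechet_derivative f (at x) = frechet_derivative g (at x)"
proof -
  have "(f has_derivative D) (at x) \<longleftrightarrow> (g has_derivative D) (at x)" for D
    using has_derivative_transform_within_open[OF _ assms(1,2), of f D UNIV g]
      has_derivative_transform_within_open[OF _ assms(1,2), of g D UNIV f] assms(3) by auto
  then show ?thesis
    by (simp add: frechet_derivative_def)
qed

lemma differentiable_cong_open:
  assumes "open S" "x \<in> S" "\<And>y. y \<in> S \<Longrightarrow> f y = g y" "f differentiable (at x)"
  shows "g differentiable (at x)"
  using has_derivative_transform_within_open[OF _ assms(1,2), of f _ UNIV g] assms(3,4)
  unfolding differentiable_def by blast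

lemma Ck_on_cong:
  assumes "open S" "\<And>y. y \<in> S \<Longrightarrow> f y = g y" "Ck_on k S f"
  shows "Ck_on k S g"
  using assms(2,3)
proof (induction k arbitrary: f g)
  case 0
  then show ?case by (simp cong: continuous_on_cong)
next
  case (Suc k)
  have "Ck_on k S (\<lambda>x. frechet_derivative g (at x) v)" for v
  proof (rule Suc.IH)
    show "Ck_on k S (\<lambda>x. frechet_derivative f (at x) v)"
      using Suc.prems by simp
    show "frechet_derivative f (at y) v = frechet_derivative g (at y) v" if "y \<in> S" for y
      using frechet_derivative_cong_open[OF assms(1) that, of f g] Suc.prems(1) by simp
  qed
  moreover have "g differentiable (at x)" if "x \<in> S" for x
    using differentiable_cong_open[OF assms(1) that, of f g] Suc.prems that by simp
  ultimately show ?case by simp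
qed

lemma Ck_on_subset: "Ck_on k S f \<Longrightarrow> T \<subseteq> S \<Longrightarrow> Ck_on k T f"
  by (induction k arbitrary: f) (auto intro: continuous_on_subset)

lemma Ck_on_Suc_D: "Ck_on (Suc k) S f \<Longrightarrow> Ck_on k S f"
proof (induction k arbitrary: f)
  case 0
  then have "\<And>x. x \<in> S \<Longrightarrow> f differentiable at x within S"
    using differentiable_at_withinI by auto
  then show ?case
    by (auto intro!: differentiable_imp_continuous_on simp: differentiable_on_def)
next
  case (Suc k)
  then show ?case unfolding Ck_on.simps(2)[of "Suc k"] Ck_on.simps(2)[of k] by blast
qed

lemma Ck_on_const: "Ck_on k S (\<lambda>x. c)"
  by (induction k arbitrary: c) auto

text \<open>Pattern of the closure lemmas: the rule of calculus gives the derivative at points of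
  \<open>S\<close>, the induction hypothesis gives the class of that formula, and
  \<open>Ck_on_cong\<close> transfers the class to the derivative itself.\<close>

lemma Ck_on_add:
  assumes "open S" "Ck_on k S f" "Ck_on k S g"
  shows "Ck_on k S (\<lambda>x. f x + g x)"
  using assms(2,3)
proof (induction k arbitrary: f g)
  case 0
  then show ?case by (simp add: continuous_on_add)
next
  case (Suc k)
  have D: "((\<lambda>x. f x + g x) has_derivative
      (\<lambda>v. frechet_derivative f (at x) v + frechet_derivative g (at x) v)) (at x)" if "x \<in> S" for x
    using Suc.prems that by (intro has_derivative_add) (auto simp: frechet_derivative_works[symmetric])
  have "Ck_on k S (\<lambda>x. frechet_derivative (\<lambda>x. f x + g x) (at x) v)" for v
  proof (rule Ck_on_cong[OF assms(1)])
    show "Ck_on k S (\<lambda>x. frechet_derivative f (at x) v + frechet_derivative g (at x) v)"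
      using Suc.prems by (intro Suc.IH) simp_all
  qed (simp add: frechet_derivative_at[OF D, symmetric])
  then show ?case using D by (auto simp: differentiable_def)
qed

lemma Ck_on_linear:
  assumes "open S" "bounded_linear L" "Ck_on k S f"
  shows "Ck_on k S (\<lambda>x. L (f x))"
  using assms(3)
proof (induction k arbitrary: f)
  case 0
  then show ?case using assms(2) by (auto intro: bounded_linear.continuous_on)
next
  case (Suc k)
  have D: "((\<lambda>x. L (f x)) has_derivative (\<lambda>v. L (frechet_derivative f (at x) v))) (at x)"
    if "x \<in> S" for x
    using Suc.prems that
    by (intro bounded_linear.has_derivative[OF assms(2)]) (auto simp: frechet_derivative_works[symmetric])
  have "Ck_on k S (\<lambda>x. frechet_derivative (\<lambda>x. L (f x)) (at x) v)" for v
  proof (rule Ck_on_cong[OF assms(1)])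
    show "Ck_on k S (\<lambda>x. L (frechet_derivative f (at x) v))"
      using Suc.prems by (intro Suc.IH) simp
  qed (simp add: frechet_derivative_at[OF D, symmetric])
  then show ?case using D by (auto simp: differentiable_def)
qed

lemma Ck_on_scaleR:
  assumes "open S" "Ck_on k S f" "Ck_on k S g"
  shows "Ck_on k S (\<lambda>x. f x *\<^sub>R g x)"
  using assms(2,3)
proof (induction k arbitrary: f g)
  case 0
  then show ?case by (simp add: continuous_on_scaleR)
next
  case (Suc k)
  have D: "((\<lambda>x. f x *\<^sub>R g x) has_derivative
      (\<lambda>v. f x *\<^sub>R frechet_derivative g (at x) v + frechet_derivative f (at x) v *\<^sub>R g x)) (at x)"
    if "x \<in> S" for x
    using Suc.prems that by (intro has_derivative_scaleR) (auto simp: frechet_derivative_works[symmetric])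
  have "Ck_on k S (\<lambda>x. frechet_derivative (\<lambda>x. f x *\<^sub>R g x) (at x) v)" for v
  proof (rule Ck_on_cong[OF assms(1)])
    show "Ck_on k S (\<lambda>x. f x *\<^sub>R frechet_derivative g (at x) v + frechet_derivative f (at x) v *\<^sub>R g x)"
      \<comment> \<open>The product rule leaves one factor undifferentiated in each term;
        \<open>Ck_on_Suc_D\<close> lowers that factor to class \<open>k\<close>.\<close>
      using Suc.prems Suc.prems[THEN Ck_on_Suc_D] by (intro Ck_on_add assms(1) Suc.IH) simp_all
  qed (simp add: frechet_derivative_at[OF D, symmetric])
  then show ?case using D by (auto simp: differentiable_def)
qed

text \<open>The derivative of 1/f is -f'/f^2, which contains 1/f again. Hence the induction keeps
  \<open>f\<close> fixed and uses its own hypothesis for those factors.\<close>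

lemma Ck_on_inverse:
  fixes f :: "'a::real_normed_vector \<Rightarrow> real"
  assumes "open S" "Ck_on k S f" "\<And>x. x \<in> S \<Longrightarrow> f x \<noteq> 0"
  shows "Ck_on k S (\<lambda>x. inverse (f x))"
  using assms(2)
proof (induction k)
  case 0
  then show ?case using assms(3) by (simp add: continuous_on_inverse)
next
  case (Suc k)
  have D: "((\<lambda>x. inverse (f x)) has_derivative
      (\<lambda>v. - (inverse (f x) * frechet_derivative f (at x) v * inverse (f x)))) (at x)"
    if "x \<in> S" for x
    using Suc.prems that assms(3)
    by (intro Deriv.has_derivative_inverse) (auto simp: frechet_derivative_works[symmetric])
  have "Ck_on k S (\<lambda>x. frechet_derivative (\<lambda>x. inverse (f x)) (at x) v)" for v
  proof (rule Ck_on_cong[OF assms(1)])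
    have "Ck_on k S (\<lambda>x. inverse (f x))"
      using Suc Ck_on_Suc_D by blast
    then show "Ck_on k S (\<lambda>x. - 1 *\<^sub>R (inverse (f x) *\<^sub>R (inverse (f x) *\<^sub>R frechet_derivative f (at x) v)))"
      using Suc.prems by (intro Ck_on_scaleR Ck_on_const assms(1)) auto
  qed (simp add: frechet_derivative_at[OF D, symmetric])
  then show ?case using D by (auto simp: differentiable_def)
qed

lemma smooth_on_cong:
  "smooth_on S f \<Longrightarrow> open S \<Longrightarrow> (\<And>y. y \<in> S \<Longrightarrow> f y = g y) \<Longrightarrow> smooth_on S g"
  unfolding smooth_on_def by (blast intro: Ck_on_cong)

lemma smooth_on_subset: "smooth_on S f \<Longrightarrow> T \<subseteq> S \<Longrightarrow> smooth_on T f"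
  unfolding smooth_on_def by (blast intro: Ck_on_subset)

lemma smooth_on_const: "smooth_on S (\<lambda>x. c)"
  by (simp add: smooth_on_def Ck_on_const)

lemma smooth_on_add:
  "open S \<Longrightarrow> smooth_on S f \<Longrightarrow> smooth_on S g \<Longrightarrow> smooth_on S (\<lambda>x. f x + g x)"
  by (simp add: smooth_on_def Ck_on_add)

lemma smooth_on_linear:
  "open S \<Longrightarrow> bounded_linear L \<Longrightarrow> smooth_on S f \<Longrightarrow> smooth_on S (\<lambda>x. L (f x))"
  by (simp add: smooth_on_def Ck_on_linear)

lemma smooth_on_scaleR:
  "open S \<Longrightarrow> smooth_on S f \<Longrightarrow> smooth_on S g \<Longrightarrow> smooth_on S (\<lambda>x. f x *\<^sub>R g x)"
  by (simp add: smooth_on_def Ck_on_scaleR)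

lemma smooth_on_mult:
  fixes f g :: "'a::real_normed_vector \<Rightarrow> real"
  shows "open S \<Longrightarrow> smooth_on S f \<Longrightarrow> smooth_on S g \<Longrightarrow> smooth_on S (\<lambda>x. f x * g x)"
  using smooth_on_scaleR[of S f g] by simp

lemma smooth_on_inverse:
  fixes f :: "'a::real_normed_vector \<Rightarrow> real"
  shows "open S \<Longrightarrow> smooth_on S f \<Longrightarrow> (\<And>x. x \<in> S \<Longrightarrow> f x \<noteq> 0) \<Longrightarrow> smooth_on S (\<lambda>x. inverse (f x))"
  by (simp add: smooth_on_def Ck_on_inverse)

lemma smooth_on_diff:
  assumes "open S" "smooth_on S f" "smooth_on S g"
  shows "smooth_on S (\<lambda>x. f x - g x)"
  using smooth_on_add[OF assms(1,2) smooth_on_linear[OF assms(1) bounded_linear_minus[OF bounded_linear_ident] assms(3)]]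
  by simp

lemma smooth_on_sum:
  assumes "open S" "\<And>i. i \<in> I \<Longrightarrow> smooth_on S (f i)"
  shows "smooth_on S (\<lambda>x. \<Sum>i\<in>I. f i x)"
  using assms(2)
  by (induction I rule: infinite_finite_induct) (auto intro: smooth_on_const smooth_on_add[OF assms(1)])

lemma smooth_on_nth: "open S \<Longrightarrow> smooth_on S f \<Longrightarrow> smooth_on S (\<lambda>x. f x $ k)"
  by (intro smooth_on_linear[of _ "\<lambda>v. v $ k"] bounded_linear_vec_nth)

lemma smooth_on_imp_differentiable: "smooth_on S f \<Longrightarrow> x \<in> S \<Longrightarrow> f differentiable (at x)"
  unfolding smooth_on_def using Ck_on.simps(2) by blast

lemma smooth_on_imp_continuous_on: "smooth_on S f \<Longrightarrow> continuous_on S f"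
  unfolding smooth_on_def by (metis Ck_on.simps(1))

lemma smooth_on_frechet_derivative:
  "smooth_on S f \<Longrightarrow> smooth_on S (\<lambda>x. frechet_derivative f (at x) v)"
  unfolding smooth_on_def using Ck_on.simps(2) by blast

lemma frechet_derivative_sum_axis:
  fixes f :: "(real, 'n::finite) vec \<Rightarrow> 'b::real_normed_vector"
  assumes "f differentiable (at x)"
  shows "frechet_derivative f (at x) v = (\<Sum>k\<in>UNIV. v $ k *\<^sub>R frechet_derivative f (at x) (axis k 1))"
proof -
  interpret linear "frechet_derivative f (at x)"
    using assms linear_frechet_derivative by blast
  have "frechet_derivative f (at x) v = frechet_derivative f (at x) (\<Sum>k\<in>UNIV. v $ k *\<^sub>R axis k 1)"
    by (simp add: basis_expansion flip: scalar_mult_eq_scaleR)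
  then show ?thesis by (simp add: sum scaleR)
qed

text \<open>\<open>Ck_on\<close> controls derivatives in a fixed direction only. Expanding
  \<open>Z x\<close> along the axes moves its dependence on \<open>x\<close> into scalar
  coefficients.\<close>

lemma smooth_on_directional_derivative:
  fixes f :: "(real, 'n::finite) vec \<Rightarrow> 'b::real_normed_vector"
  assumes "open S" "smooth_on S f" "smooth_on S Z"
  shows "smooth_on S (\<lambda>x. frechet_derivative f (at x) (Z x))"
proof (rule smooth_on_cong[OF _ assms(1)])
  show "smooth_on S (\<lambda>x. \<Sum>k\<in>UNIV. Z x $ k *\<^sub>R frechet_derivative f (at x) (axis k 1))"
    using assms by (intro smooth_on_sum smooth_on_scaleR smooth_on_nth smooth_on_frechet_derivative)
qed (use assms in \<open>simp add: smooth_on_imp_differentiable flip: frechet_derivative_sum_axis\<close>)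

lemma smooth_on_lie:
  assumes "open S" "smooth_on S X" "smooth_on S Y"
  shows "smooth_on S (lie X Y)"
proof -
  have "lie X Y = (\<lambda>x. frechet_derivative Y (at x) (X x) - frechet_derivative X (at x) (Y x))"
    by (auto simp: lie_def)
  then show ?thesis
    using assms by (simp add: smooth_on_diff smooth_on_directional_derivative)
qed

subsection \<open>Joint invariants and Lie brackets\<close>

lemma has_real_derivative_along_line:
  fixes f :: "'a::real_normed_vector \<Rightarrow> real"
  assumes "f differentiable (at (a + s *\<^sub>R u))"
  shows "((\<lambda>s. f (a + s *\<^sub>R u)) has_real_derivative frechet_derivative f (at (a + s *\<^sub>R u)) u) (at s)"
proof -
  have "((\<lambda>s. a + s *\<^sub>R u) has_derivative (\<lambda>d. d *\<^sub>R u)) (at s)"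
    by (auto intro!: derivative_eq_intros)
  moreover have D: "(f has_derivative frechet_derivative f (at (a + s *\<^sub>R u))) (at (a + s *\<^sub>R u))"
    using assms frechet_derivative_works by blast
  ultimately have "((\<lambda>s. f (a + s *\<^sub>R u)) has_derivative
      (\<lambda>d. frechet_derivative f (at (a + s *\<^sub>R u)) (d *\<^sub>R u))) (at s)"
    by (rule has_derivative_compose)
  moreover have "frechet_derivative f (at (a + s *\<^sub>R u)) (d *\<^sub>R u)
      = frechet_derivative f (at (a + s *\<^sub>R u)) u * d" for d
    using linear_cmul[OF linear_frechet_derivative[OF assms]] by simp
  ultimately show ?thesis
    by (simp add: has_field_derivative_def)
qed

text \<open>The mean value theorem is used twice: along \<open>u\<close> for the difference of
  \<open>f\<close> on two opposite sides of a parallelogram, then along \<open>v\<close> for the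
  derivative \<open>g\<close> of \<open>f\<close> in direction \<open>u\<close>.\<close>

lemma second_difference_mean_value:
  fixes f :: "'a::real_normed_vector \<Rightarrow> real"
  assumes "smooth_on S f" "h > 0"
    and S: "\<And>s t. 0 \<le> s \<Longrightarrow> s \<le> h \<Longrightarrow> 0 \<le> t \<Longrightarrow> t \<le> h \<Longrightarrow> x + s *\<^sub>R u + t *\<^sub>R v \<in> S"
  obtains s t where "0 < s" "s < h" "0 < t" "t < h"
    "f (x + h *\<^sub>R u + h *\<^sub>R v) - f (x + h *\<^sub>R u) - f (x + h *\<^sub>R v) + f x =
       h * (h * frechet_derivative (\<lambda>y. frechet_derivative f (at y) u) (at (x + s *\<^sub>R u + t *\<^sub>R v)) v)"
proof -
  define g where "g y = frechet_derivative f (at y) u" for y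
  have g: "smooth_on S g"
    unfolding g_def using assms(1) by (rule smooth_on_frechet_derivative)
  have "((\<lambda>s. f (x + h *\<^sub>R v + s *\<^sub>R u) - f (x + s *\<^sub>R u)) has_real_derivative
      g (x + h *\<^sub>R v + s *\<^sub>R u) - g (x + s *\<^sub>R u)) (at s)" if "0 \<le> s" "s \<le> h" for s
    unfolding g_def using S[of s h] S[of s 0] that assms(2)
    by (intro DERIV_diff has_real_derivative_along_line smooth_on_imp_differentiable[OF assms(1)])
      (auto simp: algebra_simps)
  from MVT2[OF assms(2) this] obtain s where s: "0 < s" "s < h" and
    "f (x + h *\<^sub>R v + h *\<^sub>R u) - f (x + h *\<^sub>R u) - (f (x + h *\<^sub>R v + 0 *\<^sub>R u) - f (x + 0 *\<^sub>R u))
      = (h - 0) * (g (x + h *\<^sub>R v + s *\<^sub>R u) - g (x + s *\<^sub>R u))"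
    by blast
  then have *: "f (x + h *\<^sub>R u + h *\<^sub>R v) - f (x + h *\<^sub>R u) - f (x + h *\<^sub>R v) + f x
      = h * (g (x + s *\<^sub>R u + h *\<^sub>R v) - g (x + s *\<^sub>R u))"
    by (simp add: ac_simps)
  have "((\<lambda>t. g (x + s *\<^sub>R u + t *\<^sub>R v)) has_real_derivative
      frechet_derivative g (at (x + s *\<^sub>R u + t *\<^sub>R v)) v) (at t)" if "0 \<le> t" "t \<le> h" for t
    using S[of s t] that s
    by (intro has_real_derivative_along_line smooth_on_imp_differentiable[OF g]) auto
  from MVT2[OF assms(2) this] obtain t where "0 < t" "t < h" and
    "g (x + s *\<^sub>R u + h *\<^sub>R v) - g (x + s *\<^sub>R u + 0 *\<^sub>R v)
      = (h - 0) * frechet_derivative g (at (x + s *\<^sub>R u + t *\<^sub>R v)) v"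
    by blast
  with that[of s t] s * show ?thesis
    by (simp add: g_def[abs_def])
qed

text \<open>The second difference over a parallelogram does not depend on the order of
  \<open>u\<close> and \<open>v\<close>. By the mean value form, the two mixed derivatives agree at
  a pair of points close to \<open>x\<close>, and continuity brings both points to
  \<open>x\<close>.\<close>

lemma symmetric_second_derivative:
  fixes f :: "'a::real_normed_vector \<Rightarrow> real"
  assumes "open S" "smooth_on S f" "x \<in> S"
  shows "frechet_derivative (\<lambda>y. frechet_derivative f (at y) u) (at x) v =
    frechet_derivative (\<lambda>y. frechet_derivative f (at y) v) (at x) u"
proof -
  define F where "F u v x = frechet_derivative (\<lambda>y. frechet_derivative f (at y) u) (at x) v" for u v x
  have cont: "isCont (F u v) x" for u v
  proof -
    have "continuous_on S (F u v)"
      unfolding F_def[abs_def]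
      by (intro smooth_on_imp_continuous_on smooth_on_frechet_derivative assms(2))
    then show ?thesis using assms(1,3) continuous_on_eq_continuous_at by blast
  qed
  have "dist (F u v x) (F v u x) \<le> e" if e: "e > 0" for e
  proof -
    obtain d1 where d1: "d1 > 0" "\<And>y. dist y x < d1 \<Longrightarrow> dist (F u v y) (F u v x) < e / 2"
      using cont[of u v] half_gt_zero[OF e] unfolding continuous_at_eps_delta by blast
    obtain d2 where d2: "d2 > 0" "\<And>y. dist y x < d2 \<Longrightarrow> dist (F v u y) (F v u x) < e / 2"
      using cont[of v u] half_gt_zero[OF e] unfolding continuous_at_eps_delta by blast
    obtain d3 where d3: "d3 > 0" "ball x d3 \<subseteq> S"
      using assms open_contains_ball by blast
    \<comment> \<open>\<open>d\<close> serves both continuity estimates and containment in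
      \<open>S\<close>; \<open>h\<close> keeps the parallelogram within distance \<open>d\<close> of
      \<open>x\<close>. The summand 1 keeps the divisor positive when \<open>u\<close> and
      \<open>v\<close> are both zero.\<close>
    define d where "d = min d1 (min d2 d3)"
    define h where "h = d / (norm u + norm v + 1)"
    have "d > 0" using d1 d2 d3 by (simp add: d_def)
    moreover have N: "norm u + norm v + 1 > 0"
      using norm_ge_zero[of u] norm_ge_zero[of v] by linarith
    ultimately have "h > 0" by (simp add: h_def)
    \<comment> \<open>Stated for \<open>a\<close> and \<open>b\<close> with the same total norm, so
      that it covers both orders of \<open>u\<close> and \<open>v\<close>.\<close>
    have near: "dist (x + s *\<^sub>R a + t *\<^sub>R b) x < d"
      if "0 \<le> s" "s \<le> h" "0 \<le> t" "t \<le> h" "norm a + norm b = norm u + norm v" for s t a b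
    proof -
      have "dist (x + s *\<^sub>R a + t *\<^sub>R b) x = norm (s *\<^sub>R a + t *\<^sub>R b)"
        by (simp add: dist_norm)
      also have "\<dots> \<le> s * norm a + t * norm b"
        using that by (metis abs_of_nonneg norm_scaleR norm_triangle_ineq)
      also have "\<dots> \<le> h * norm a + h * norm b"
        using that by (intro add_mono mult_right_mono) auto
      also have "\<dots> = h * (norm u + norm v)"
        by (simp add: that(5) flip: distrib_left)
      also have "\<dots> < h * (norm u + norm v + 1)"
        using \<open>h > 0\<close> by simp
      also have "\<dots> = d"
        using N by (simp add: h_def)
      finally show ?thesis .
    qed
    have ball: "y \<in> S" if "dist y x < d" for y
      using that d3(2) by (auto simp: d_def dist_commute)
    obtain s t where st: "0 < s" "s < h" "0 < t" "t < h"
      "f (x + h *\<^sub>R u + h *\<^sub>R v) - f (x + h *\<^sub>R u) - f (x + h *\<^sub>R v) + f x =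
       h * (h * F u v (x + s *\<^sub>R u + t *\<^sub>R v))"
      unfolding F_def using second_difference_mean_value[OF assms(2) \<open>h > 0\<close>, of x u v] near[of _ _ u v] ball
      by metis
    obtain s' t' where st': "0 < s'" "s' < h" "0 < t'" "t' < h"
      "f (x + h *\<^sub>R v + h *\<^sub>R u) - f (x + h *\<^sub>R v) - f (x + h *\<^sub>R u) + f x =
       h * (h * F v u (x + s' *\<^sub>R v + t' *\<^sub>R u))"
      unfolding F_def using second_difference_mean_value[OF assms(2) \<open>h > 0\<close>, of x v u] near[of _ _ v u] ball
      by (metis add.commute)
    have "x + h *\<^sub>R v + h *\<^sub>R u = x + h *\<^sub>R u + h *\<^sub>R v"
      by (simp add: ac_simps)
    then have "f (x + h *\<^sub>R v + h *\<^sub>R u) = f (x + h *\<^sub>R u + h *\<^sub>R v)"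
      by (rule arg_cong)
    with st(5) st'(5) have "h * (h * F u v (x + s *\<^sub>R u + t *\<^sub>R v)) = h * (h * F v u (x + s' *\<^sub>R v + t' *\<^sub>R u))"
      by linarith
    then have "F u v (x + s *\<^sub>R u + t *\<^sub>R v) = F v u (x + s' *\<^sub>R v + t' *\<^sub>R u)"
      using \<open>h > 0\<close> by simp
    moreover have "dist (F u v (x + s *\<^sub>R u + t *\<^sub>R v)) (F u v x) < e / 2"
      using near[of s t u v] st by (intro d1) (simp add: d_def)
    moreover have "dist (F v u (x + s' *\<^sub>R v + t' *\<^sub>R u)) (F v u x) < e / 2"
      using near[of s' t' v u] st' by (intro d2) (simp add: d_def)
    ultimately show ?thesis
      by (metis dist_triangle_half_r less_le)
  qed
  then have "dist (F u v x) (F v u x) \<le> 0"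
    by (rule field_le_epsilon) simp
  then show ?thesis by (simp add: F_def)
qed

section \<open>Invariance under brackets and row operations\<close>

text \<open>Differentiating Df(Y) = 0 in direction \<open>w\<close> gives a term with the derivative
  of \<open>Y\<close> and a second derivative of \<open>f\<close>; symmetry then moves
  \<open>w\<close> into the inner slot.\<close>

lemma derivative_of_invariance:
  fixes f :: "(real, 'n::finite) vec \<Rightarrow> real"
  assumes "open S" "smooth_on S f" "smooth_on S Y" "x \<in> S"
    and inv: "\<And>y. y \<in> S \<Longrightarrow> vf_apply Y f y = 0"
  shows "frechet_derivative f (at x) (frechet_derivative Y (at x) w) =
    - frechet_derivative (\<lambda>y. frechet_derivative f (at y) w) (at x) (Y x)"
proof -
  define g where "g u y = frechet_derivative f (at y) u" for u y
  have g: "smooth_on S (g u)" for u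
    unfolding g_def using assms(2) by (rule smooth_on_frechet_derivative)
  \<comment> \<open>In Df(Y) both the base point and the direction move. Coordinates make it a
    finite sum of products of real functions, to which the product rule applies.\<close>
  have D: "((\<lambda>y. \<Sum>k\<in>UNIV. Y y $ k * g (axis k 1) y) has_derivative
      (\<lambda>w. \<Sum>k\<in>UNIV. Y x $ k * frechet_derivative (g (axis k 1)) (at x) w
          + frechet_derivative Y (at x) w $ k * g (axis k 1) x)) (at x)"
    using smooth_on_imp_differentiable[OF g assms(4)] smooth_on_imp_differentiable[OF assms(3,4)]
    by (intro has_derivative_sum has_derivative_mult bounded_linear.has_derivative[OF bounded_linear_vec_nth])
      (auto simp: frechet_derivative_works[symmetric])
  have zero: "(\<Sum>k\<in>UNIV. Y y $ k * g (axis k 1) y) = 0" if "y \<in> S" for y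
    using inv[OF that] frechet_derivative_sum_axis[OF smooth_on_imp_differentiable[OF assms(2) that], of "Y y"]
    by (simp add: vf_apply_def g_def)
  have "((\<lambda>y. \<Sum>k\<in>UNIV. Y y $ k * g (axis k 1) y) has_derivative (\<lambda>w. 0)) (at x)"
    by (rule has_derivative_transform_within_open[OF has_derivative_const assms(1,4) zero[symmetric]])
  then have "(\<Sum>k\<in>UNIV. Y x $ k * frechet_derivative (g (axis k 1)) (at x) w
          + frechet_derivative Y (at x) w $ k * g (axis k 1) x) = 0"
    by (rule has_derivative_unique[OF D, THEN fun_cong])
  moreover have "(\<Sum>k\<in>UNIV. frechet_derivative Y (at x) w $ k * g (axis k 1) x)
      = frechet_derivative f (at x) (frechet_derivative Y (at x) w)"
    unfolding g_def
    by (subst (2) frechet_derivative_sum_axis[OF smooth_on_imp_differentiable[OF assms(2,4)]]) simp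
  moreover have "(\<Sum>k\<in>UNIV. Y x $ k * frechet_derivative (g (axis k 1)) (at x) w)
      = frechet_derivative (g w) (at x) (Y x)"
  proof -
    have "frechet_derivative (g (axis k 1)) (at x) w = frechet_derivative (g w) (at x) (axis k 1)" for k
      unfolding g_def[abs_def] by (rule symmetric_second_derivative[OF assms(1,2,4)])
    then show ?thesis
      by (subst frechet_derivative_sum_axis[OF smooth_on_imp_differentiable[OF g assms(4)]]) simp
  qed
  ultimately show ?thesis
    by (simp add: sum.distrib g_def[abs_def])
qed

text \<open>Each half of the bracket becomes a second derivative of \<open>f\<close> by
  \<open>derivative_of_invariance\<close>, once in direction \<open>Z x\<close> and once in
  direction \<open>Y x\<close>. The two cancel by symmetry.\<close>

lemma lie_invariant:
  fixes f :: "(real, 'n::finite) vec \<Rightarrow> real"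
  assumes "open S" "smooth_on S f" "smooth_on S Y" "smooth_on S Z" "x \<in> S"
    and "\<And>y. y \<in> S \<Longrightarrow> vf_apply Y f y = 0" "\<And>y. y \<in> S \<Longrightarrow> vf_apply Z f y = 0"
  shows "vf_apply (lie Y Z) f x = 0"
  using linear_diff[OF linear_frechet_derivative[OF smooth_on_imp_differentiable[OF assms(2,5)]]]
    derivative_of_invariance[OF assms(1-3,5,6), of "Z x"]
    derivative_of_invariance[OF assms(1,2,4,5,7), of "Y x"]
    symmetric_second_derivative[OF assms(1,2,5), of "Y x" "Z x"]
  by (simp add: vf_apply_def lie_def)

lemma vf_apply_combination:
  assumes "f differentiable (at x)" "F x = (\<Sum>j<m. A j x *\<^sub>R Z j x)"
    and "\<And>j. j < m \<Longrightarrow> vf_apply (Z j) f x = 0"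
  shows "vf_apply F f x = 0"
proof -
  interpret linear "frechet_derivative f (at x)"
    using assms(1) by (rule linear_frechet_derivative)
  show ?thesis
    using assms(3) by (simp add: vf_apply_def assms(2) sum scaleR)
qed

text \<open>At each point the fields annihilating \<open>f\<close> form a linear space, so
  expressing each family through the other suffices.\<close>

lemma joint_invariant_row_equiv:
  assumes "row_equiv_on W X d Y r" "S \<subseteq> W"
  shows "joint_invariant S X d f \<longleftrightarrow> joint_invariant S Y r f"
proof -
  obtain A B where
    A: "\<forall>x\<in>W. \<forall>i<r. Y i x = (\<Sum>j<d. A i j x *\<^sub>R X j x)" and
    B: "\<forall>x\<in>W. \<forall>j<d. X j x = (\<Sum>i<r. B j i x *\<^sub>R Y i x)"
    using assms(1) unfolding row_equiv_on_def by blast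
  have "vf_apply (Y i) f x = 0"
    if "smooth_on S f" "\<forall>j<d. \<forall>x\<in>S. vf_apply (X j) f x = 0" "i < r" "x \<in> S" for i x
    using A that assms(2)
    by (intro vf_apply_combination[of f x "Y i" "A i" X d]) (auto intro: smooth_on_imp_differentiable)
  moreover have "vf_apply (X j) f x = 0"
    if "smooth_on S f" "\<forall>i<r. \<forall>x\<in>S. vf_apply (Y i) f x = 0" "j < d" "x \<in> S" for j x
    using B that assms(2)
    by (intro vf_apply_combination[of f x "X j" "B j" Y r]) (auto intro: smooth_on_imp_differentiable)
  ultimately show ?thesis
    unfolding joint_invariant_def by blast
qed

subsection \<open>Row reduction with smooth coefficients\<close>

text \<open>This isolates what a single row of the matrix \<open>A\<close> in
  \<open>row_equiv_on\<close> asserts, so that elimination can be done row by row.\<close>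

definition smooth_combination ::
    "(real, 'n::finite) vec set \<Rightarrow> (nat \<Rightarrow> 'n vf) \<Rightarrow> nat \<Rightarrow> 'n vf \<Rightarrow> bool" where
  "smooth_combination V Z e F \<longleftrightarrow>
     (\<exists>A. (\<forall>j. smooth_on V (A j)) \<and> (\<forall>x\<in>V. F x = (\<Sum>j<e. A j x *\<^sub>R Z j x)))"

lemma smooth_combination_subset:
  "smooth_combination V Z e F \<Longrightarrow> V' \<subseteq> V \<Longrightarrow> smooth_combination V' Z e F"
  unfolding smooth_combination_def by (meson smooth_on_subset subsetD)

lemma smooth_combination_member:
  assumes "j < e"
  shows "smooth_combination V Z e (Z j)"
  unfolding smooth_combination_def
  using assms
  by (intro exI[of _ "\<lambda>i x. if i = j then 1 else 0"])
    (auto simp: smooth_on_const if_distrib[of "\<lambda>c. c *\<^sub>R _"] cong: if_cong)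

lemma smooth_combination_scaleR:
  assumes "open V" "smooth_combination V Z e F" "smooth_on V a"
  shows "smooth_combination V Z e (\<lambda>x. a x *\<^sub>R F x)"
proof -
  obtain A where A: "\<And>j. smooth_on V (A j)" "\<And>x. x \<in> V \<Longrightarrow> F x = (\<Sum>j<e. A j x *\<^sub>R Z j x)"
    using assms(2) unfolding smooth_combination_def by blast
  show ?thesis
    unfolding smooth_combination_def using A assms(1,3)
    by (intro exI[of _ "\<lambda>j x. a x * A j x"]) (auto intro: smooth_on_mult simp: scaleR_sum_right)
qed

lemma smooth_combination_diff:
  assumes "open V" "smooth_combination V Z e F" "smooth_combination V Z e G"
  shows "smooth_combination V Z e (\<lambda>x. F x - G x)"
proof -
  obtain A where A: "\<And>j. smooth_on V (A j)" "\<And>x. x \<in> V \<Longrightarrow> F x = (\<Sum>j<e. A j x *\<^sub>R Z j x)"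
    using assms(2) unfolding smooth_combination_def by blast
  obtain B where B: "\<And>j. smooth_on V (B j)" "\<And>x. x \<in> V \<Longrightarrow> G x = (\<Sum>j<e. B j x *\<^sub>R Z j x)"
    using assms(3) unfolding smooth_combination_def by blast
  show ?thesis
    unfolding smooth_combination_def using A B assms(1)
    by (intro exI[of _ "\<lambda>j x. A j x - B j x"])
      (auto intro: smooth_on_diff simp: scaleR_left_diff_distrib sum_subtractf)
qed

lemma smooth_combination_diff_sum:
  assumes "open V" "smooth_combination V Z e F" "\<And>p. p \<in> P \<Longrightarrow> smooth_combination V Z e (G p)"
  shows "smooth_combination V Z e (\<lambda>x. F x - (\<Sum>p\<in>P. G p x))"
  using assms(3)
proof (induction P rule: infinite_finite_induct)
  case (insert p P)
  have "smooth_combination V Z e (\<lambda>x. (F x - (\<Sum>p\<in>P. G p x)) - G p x)"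
    by (rule smooth_combination_diff[OF assms(1)]) (use insert in simp_all)
  with insert.hyps show ?case by (simp add: diff_diff_eq add.commute)
qed (use assms(2) in simp_all)

lemma smooth_combination_imp_smooth_on:
  assumes "open V" "\<And>j. j < e \<Longrightarrow> smooth_on V (Z j)" "smooth_combination V Z e F"
  shows "smooth_on V F"
proof -
  obtain A where A: "\<And>j. smooth_on V (A j)" "\<And>x. x \<in> V \<Longrightarrow> F x = (\<Sum>j<e. A j x *\<^sub>R Z j x)"
    using assms(3) unfolding smooth_combination_def by blast
  have "smooth_on V (\<lambda>x. \<Sum>j<e. A j x *\<^sub>R Z j x)"
    using A(1) assms(1,2) by (intro smooth_on_sum smooth_on_scaleR) auto
  then show ?thesis
    using assms(1) by (rule smooth_on_cong) (simp add: A(2))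
qed

text \<open>Rows indexed by their pivot columns, with an identity matrix in those columns; unlike in
  \<^const>\<open>rref_on\<close>, entries to the left of a pivot need not vanish.\<close>
definition pivot_frame ::
    "(real, 'n::finite) vec set \<Rightarrow> (nat \<Rightarrow> 'n vf) \<Rightarrow> nat \<Rightarrow> (real, 'n) vec set \<Rightarrow> 'n set \<Rightarrow> ('n \<Rightarrow> 'n vf) \<Rightarrow> bool" where
  "pivot_frame W Z e V P Y \<longleftrightarrow>
     open V \<and> V \<subseteq> W \<and> (\<forall>p\<in>P. smooth_combination V Z e (Y p)) \<and>
     (\<forall>p\<in>P. \<forall>q\<in>P. \<forall>x\<in>V. Y p x $ q = (if p = q then 1 else 0))"

text \<open>One pivoting step: scale \<open>F\<close> to have entry 1 in column \<open>q\<close> and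
  clear that column in the other rows. The columns of \<open>Q\<close> are undisturbed because
  \<open>F\<close> vanishes there. Taking \<open>Q = P\<close> enlarges a frame; removing one
  element of \<open>P\<close> first exchanges a pivot.\<close>

lemma pivot_frame_insert:
  fixes Z :: "nat \<Rightarrow> 'n::finite vf"
  assumes frame: "pivot_frame W Z e V P Y" and smooth: "\<And>j. j < e \<Longrightarrow> smooth_on W (Z j)"
    and "Q \<subseteq> P" "q \<notin> Q"
    and F: "smooth_combination V Z e F" "\<And>p x. p \<in> Q \<Longrightarrow> x \<in> V \<Longrightarrow> F x $ p = 0"
    and x0: "x0 \<in> V" "F x0 $ q \<noteq> 0"
  obtains V' Y' where "x0 \<in> V'" "pivot_frame W Z e V' (insert q Q) Y'"
proof -
  have V: "open V" "V \<subseteq> W"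
    using frame by (auto simp: pivot_frame_def)
  have smV: "\<And>j. j < e \<Longrightarrow> smooth_on V (Z j)"
    using smooth V(2) smooth_on_subset by blast
  \<comment> \<open>The open set where division by the new pivot entry is possible.\<close>
  define V' where "V' = V \<inter> (\<lambda>x. F x $ q) -` (- {0})"
  have smF: "smooth_on V (\<lambda>x. F x $ q)"
    using smooth_combination_imp_smooth_on[OF V(1) smV F(1)] V(1) by (intro smooth_on_nth)
  then have V': "open V'"
    unfolding V'_def by (intro continuous_open_preimage V(1) smooth_on_imp_continuous_on) auto
  have sub: "V' \<subseteq> V" by (simp add: V'_def)
  define G where "G x = inverse (F x $ q) *\<^sub>R F x" for x
  define Y' where "Y' p = (if p = q then G else (\<lambda>x. Y p x - Y p x $ q *\<^sub>R G x))" for p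
  have Gq: "G x $ q = 1" if "x \<in> V'" for x
    using that by (simp add: G_def V'_def)
  have Gp: "G x $ p = 0" if "x \<in> V'" "p \<in> Q" for x p
    using that F(2) sub by (auto simp: G_def)
  have G: "smooth_combination V' Z e G"
    unfolding G_def[abs_def] using V' smF F(1) sub
    by (intro smooth_combination_scaleR smooth_on_inverse)
      (auto intro: smooth_combination_subset smooth_on_subset simp: V'_def)
  have Y: "smooth_combination V' Z e (Y p)" if "p \<in> Q" for p
    using frame sub that \<open>Q \<subseteq> P\<close> by (auto simp: pivot_frame_def intro: smooth_combination_subset)
  have "smooth_on V' (Z j)" if "j < e" for j
    using smV[OF that] sub by (rule smooth_on_subset)
  then have "smooth_on V' (\<lambda>x. Y p x $ q)" if "p \<in> Q" for p
    using smooth_combination_imp_smooth_on[OF V' _ Y[OF that]] V' by (intro smooth_on_nth) auto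
  then have "\<forall>p\<in>insert q Q. smooth_combination V' Z e (Y' p)"
    unfolding Y'_def using G Y V' by (auto intro!: smooth_combination_diff smooth_combination_scaleR)
  moreover have "Y' p x $ p' = (if p = p' then 1 else 0)"
    if "p \<in> insert q Q" "p' \<in> insert q Q" "x \<in> V'" for p p' x
    using that frame \<open>Q \<subseteq> P\<close> \<open>q \<notin> Q\<close> sub
    by (auto simp: Y'_def Gq Gp pivot_frame_def subset_iff)
  ultimately have "pivot_frame W Z e V' (insert q Q) Y'"
    using V' V(2) sub by (auto simp: pivot_frame_def)
  moreover have "x0 \<in> V'" using x0 by (simp add: V'_def)
  ultimately show ?thesis using that by blast
qed

text \<open>Subtracting from \<open>Z j\<close> its components along the frame leaves a row that
  vanishes in all pivot columns. A nonzero entry of it at \<open>x0\<close> would be a further pivot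
  near \<open>x0\<close>, against maximality.\<close>

lemma pivot_frame_spans:
  fixes Z :: "nat \<Rightarrow> 'n::finite vf"
  assumes frame: "pivot_frame W Z e V P Y" and smooth: "\<And>j. j < e \<Longrightarrow> smooth_on W (Z j)"
    and "x0 \<in> V" "j < e"
    and max: "\<And>V' P' Y'. x0 \<in> V' \<Longrightarrow> pivot_frame W Z e V' P' Y' \<Longrightarrow> card P' \<le> card P"
  shows "Z j x0 = (\<Sum>p\<in>P. Z j x0 $ p *\<^sub>R Y p x0)"
proof (rule ccontr)
  define F where "F x = Z j x - (\<Sum>p\<in>P. Z j x $ p *\<^sub>R Y p x)" for x
  assume "\<not> ?thesis"
  then obtain q where q: "F x0 $ q \<noteq> 0"
    unfolding F_def vec_eq_iff by auto
  have V: "open V" "V \<subseteq> W"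
    using frame by (auto simp: pivot_frame_def)
  have F: "smooth_combination V Z e F"
    unfolding F_def[abs_def] using V smooth[OF \<open>j < e\<close>] frame \<open>j < e\<close>
    by (intro smooth_combination_diff_sum smooth_combination_member smooth_combination_scaleR)
      (auto intro: smooth_on_nth smooth_on_subset simp: pivot_frame_def)
  have F0: "F x $ p = 0" if "p \<in> P" "x \<in> V" for x p
  proof -
    have "(\<Sum>p'\<in>P. Z j x $ p' * Y p' x $ p) = (\<Sum>p'\<in>P. if p' = p then Z j x $ p' else 0)"
      using frame that by (intro sum.cong) (auto simp: pivot_frame_def)
    then show ?thesis using that by (simp add: F_def)
  qed
  have "q \<notin> P" using q F0 \<open>x0 \<in> V\<close> by blast
  then obtain V' Y' where "x0 \<in> V'" "pivot_frame W Z e V' (insert q P) Y'"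
    using pivot_frame_insert[OF frame smooth _ _ F F0 \<open>x0 \<in> V\<close> q, of P] by auto
  then have "card (insert q P) \<le> card P" by (rule max)
  with \<open>q \<notin> P\<close> show False by simp
qed

text \<open>A frame with the most pivots around \<open>x0\<close> spans all rows at
  \<open>x0\<close>. This lets a bound on the number of pivots over all frames bound the rank at
  every point of \<open>W\<close>.\<close>

lemma dim_le_card_pivot_frame:
  fixes Z :: "nat \<Rightarrow> 'n::finite vf"
  assumes "open W" "\<And>j. j < e \<Longrightarrow> smooth_on W (Z j)" "x0 \<in> W"
  obtains V P Y where "x0 \<in> V" "pivot_frame W Z e V P Y" "dim {Z j x0 | j. j < e} \<le> card P"
proof -
  define \<F> where "\<F> P \<longleftrightarrow> (\<exists>V Y. x0 \<in> V \<and> pivot_frame W Z e V P Y)" for P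
  have "\<F> {}"
    unfolding \<F>_def using assms by (auto simp: pivot_frame_def)
  then obtain P where P: "\<F> P" "\<And>P'. \<F> P' \<Longrightarrow> card P' \<le> card P"
    using ex_has_greatest_nat[of \<F> "{}" card "Suc CARD('n)"]
    by (auto simp: card_mono less_Suc_eq_le)
  from P(1) obtain V Y where VY: "x0 \<in> V" "pivot_frame W Z e V P Y"
    unfolding \<F>_def by blast
  have "Z j x0 \<in> span ((\<lambda>p. Y p x0) ` P)" if "j < e" for j
  proof -
    have "Z j x0 = (\<Sum>p\<in>P. Z j x0 $ p *\<^sub>R Y p x0)"
      using P(2) by (intro pivot_frame_spans[OF VY(2) assms(2) VY(1) that]) (auto simp: \<F>_def)
    moreover have "(\<Sum>p\<in>P. Z j x0 $ p *\<^sub>R Y p x0) \<in> span ((\<lambda>p. Y p x0) ` P)"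
      by (intro span_sum span_scale span_base imageI)
    ultimately show ?thesis by metis
  qed
  then have "dim {Z j x0 | j. j < e} \<le> card ((\<lambda>p. Y p x0) ` P)"
    by (intro dim_le_card) auto
  also have "\<dots> \<le> card P"
    by (rule card_image_le) simp
  finally show ?thesis using that VY by blast
qed

section \<open>Existence of a reduced row echelon form\<close>

text \<open>Passes from rows indexed by pivot columns to numbered rows: sorting \<open>P\<close>
  makes the pivots increase. The original rows are recovered with their own entries in the pivot
  columns as coefficients.\<close>

lemma step1_pivot_frame:
  fixes Z :: "nat \<Rightarrow> 'n::{finite,wellorder} vf"
  assumes frame: "pivot_frame W Z e V P Y" "V \<noteq> {}"
    and smooth: "\<And>j. j < e \<Longrightarrow> smooth_on W (Z j)"
    and rank: "\<And>x. x \<in> W \<Longrightarrow> dim {Z j x | j. j < e} \<le> card P"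
    and spans: "\<And>x j. x \<in> V \<Longrightarrow> j < e \<Longrightarrow> Z j x = (\<Sum>p\<in>P. Z j x $ p *\<^sub>R Y p x)"
    and lead: "\<And>x p k. x \<in> V \<Longrightarrow> p \<in> P \<Longrightarrow> k < p \<Longrightarrow> Y p x $ k = 0"
  shows "step1 Z e W (\<lambda>i. Y (sorted_list_of_set P ! i)) (card P) V"
proof -
  define s where "s i = sorted_list_of_set P ! i" for i
  have bij: "bij_betw s {..<card P} P"
    unfolding s_def[abs_def] by (rule bij_betw_nth) simp_all
  have sP: "s i \<in> P" if "i < card P" for i
    using bij that by (auto simp: bij_betw_def)
  have mono: "s i < s j" if "i < j" "j < card P" for i j
    using that by (simp add: s_def sorted_wrt_nth_less[OF strict_sorted_list_of_set])
  have inj: "s i = s j \<longleftrightarrow> i = j" if "i < card P" "j < card P" for i j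
    using bij that by (auto simp: bij_betw_def inj_on_def)
  have V: "open V" "V \<subseteq> W" "\<And>p. p \<in> P \<Longrightarrow> smooth_combination V Z e (Y p)"
    "\<And>p q x. p \<in> P \<Longrightarrow> q \<in> P \<Longrightarrow> x \<in> V \<Longrightarrow> Y p x $ q = (if p = q then 1 else 0)"
    using frame by (auto simp: pivot_frame_def)
  have "rref_on V (\<lambda>i. Y (s i)) (card P)"
    unfolding rref_on_def using mono lead sP inj V(4)
    by (intro exI[of _ s]) auto
  moreover have "row_equiv_on V Z e (\<lambda>i. Y (s i)) (card P)"
  proof -
    obtain A where A: "\<And>p j. p \<in> P \<Longrightarrow> smooth_on V (A p j)"
      "\<And>p x. p \<in> P \<Longrightarrow> x \<in> V \<Longrightarrow> Y p x = (\<Sum>j<e. A p j x *\<^sub>R Z j x)"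
      using V(3) unfolding smooth_combination_def by metis
    \<comment> \<open>\<open>row_equiv_on\<close> asks for smooth coefficients at all indices, hence
      the zero function outside the range.\<close>
    define A' where "A' i j = (if i < card P then A (s i) j else (\<lambda>x. 0))" for i j
    define B where "B j i = (if j < e then \<lambda>x. Z j x $ s i else (\<lambda>x. 0))" for j i
    have "smooth_on V (A' i j)" for i j
      using A(1) sP by (simp add: A'_def smooth_on_const)
    moreover have "smooth_on V (B j i)" for j i
      using smooth_on_subset[OF smooth V(2)] V(1) by (simp add: B_def smooth_on_const smooth_on_nth)
    moreover have "Y (s i) x = (\<Sum>j<e. A' i j x *\<^sub>R Z j x)" if "x \<in> V" "i < card P" for x i
      using A(2) sP that by (simp add: A'_def)
    moreover have "Z j x = (\<Sum>i<card P. B j i x *\<^sub>R Y (s i) x)" if "x \<in> V" "j < e" for x j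
      using spans[OF that] sum.reindex_bij_betw[OF bij, of "\<lambda>p. Z j x $ p *\<^sub>R Y p x"] that
      by (simp add: B_def)
    ultimately show ?thesis
      unfolding row_equiv_on_def by (intro exI[of _ A'] exI[of _ B]) blast
  qed
  ultimately show ?thesis
    using V frame(2) rank by (simp add: step1_def s_def)
qed

lemma step1_exists:
  fixes Z :: "nat \<Rightarrow> 'n::{finite,wellorder} vf"
  assumes "open W" "W \<noteq> {}" and smooth: "\<And>j. j < e \<Longrightarrow> smooth_on W (Z j)"
  obtains Y r W' where "step1 Z e W Y r W'"
proof -
  define \<F> where "\<F> P \<longleftrightarrow> (\<exists>V Y. V \<noteq> {} \<and> pivot_frame W Z e V P Y)" for P
  \<comment> \<open>\<open>\<mu>\<close> adds up the numbers of columns left of the pivots, so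
    moving one pivot to the left strictly decreases it.\<close>
  define \<mu> where "\<mu> P = (\<Sum>p\<in>P. card {..<p})" for P :: "'n set"
  have "\<F> {}"
    unfolding \<F>_def using assms by (auto simp: pivot_frame_def)
  then obtain P0 where P0: "\<F> P0" "\<And>P. \<F> P \<Longrightarrow> card P \<le> card P0"
    using ex_has_greatest_nat[of \<F> "{}" card "Suc CARD('n)"]
    by (auto simp: card_mono less_Suc_eq_le)
  define \<G> where "\<G> P \<longleftrightarrow> \<F> P \<and> card P = card P0" for P
  obtain P where P: "\<G> P" "\<And>P'. \<G> P' \<Longrightarrow> \<mu> P \<le> \<mu> P'"
    using ex_has_least_nat[of \<G> P0 \<mu>] P0(1) by (auto simp: \<G>_def)
  \<comment> \<open>The comparison ranges over frames on any nonempty open subset of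
    \<open>W\<close>, in particular over those around a given point. It thus yields both spanning on
    \<open>V\<close> and the rank bound on \<open>W\<close>.\<close>
  have max: "card P' \<le> card P" if "\<F> P'" for P'
    using P0(2)[OF that] P(1) by (simp add: \<G>_def)
  from P(1) obtain V Y where VY: "V \<noteq> {}" "pivot_frame W Z e V P Y"
    unfolding \<F>_def \<G>_def by blast
  have VY': "\<And>p. p \<in> P \<Longrightarrow> smooth_combination V Z e (Y p)"
    "\<And>p q x. p \<in> P \<Longrightarrow> q \<in> P \<Longrightarrow> x \<in> V \<Longrightarrow> Y p x $ q = (if p = q then 1 else 0)"
    using VY(2) by (auto simp: pivot_frame_def)
  have "Z j x = (\<Sum>p\<in>P. Z j x $ p *\<^sub>R Y p x)" if "x \<in> V" "j < e" for x j
    using max by (intro pivot_frame_spans[OF VY(2) smooth that]) (auto simp: \<F>_def)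
  moreover have "dim {Z j x | j. j < e} \<le> card P" if x: "x \<in> W" for x
  proof -
    obtain V' P' Y' where "x \<in> V'" "pivot_frame W Z e V' P' Y'" "dim {Z j x | j. j < e} \<le> card P'"
      by (rule dim_le_card_pivot_frame[OF assms(1) smooth x])
    moreover from this have "\<F> P'"
      unfolding \<F>_def by blast
    ultimately show ?thesis using max[of P'] by simp
  qed
  moreover have "Y p x $ k = 0" if xpk: "x \<in> V" "p \<in> P" "k < p" for x p k
  proof (cases "k \<in> P")
    case True
    then show ?thesis using VY' xpk by auto
  next
    case False
    show ?thesis
    proof (rule ccontr)
      \<comment> \<open>A nonzero entry left of the pivot \<open>p\<close> allows the row
        \<open>Y p\<close> to pivot on \<open>k\<close> instead. The number of pivots is unchanged,
        but \<open>\<mu>\<close> drops, against the choice of \<open>P\<close>.\<close>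
      assume "Y p x $ k \<noteq> 0"
      moreover have "Y p x' $ p' = 0" if "p' \<in> P - {p}" "x' \<in> V" for p' x'
        using that VY'(2)[of p p' x'] xpk(2) by auto
      ultimately obtain V' Y' where V'Y': "x \<in> V'" "pivot_frame W Z e V' (insert k (P - {p})) Y'"
        using pivot_frame_insert[OF VY(2) smooth _ _ VY'(1)[OF xpk(2)] _ xpk(1), of "P - {p}" k] False
        by blast
      then have "\<F> (insert k (P - {p}))"
        unfolding \<F>_def by blast
      moreover have "card (insert k (P - {p})) = card P"
        using False xpk card_Suc_Diff1[of P p] by simp
      ultimately have "\<G> (insert k (P - {p}))"
        using P(1) by (simp add: \<G>_def)
      then have "\<mu> P \<le> \<mu> (insert k (P - {p}))" by (rule P(2))
      moreover have "\<mu> (insert k (P - {p})) = card {..<k} + \<mu> (P - {p})"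
        using False by (simp add: \<mu>_def)
      moreover have "\<mu> P = card {..<p} + \<mu> (P - {p})"
        unfolding \<mu>_def using xpk(2) by (intro sum.remove) simp_all
      moreover have "card {..<k} < card {..<p}"
        using xpk by (intro psubset_card_mono) auto
      ultimately show False by simp
    qed
  qed
  ultimately show ?thesis
    using step1_pivot_frame[OF VY(2,1) smooth] that by blast
qed

subsection \<open>Iterating the process\<close>

lemma step1_smooth_on:
  assumes "step1 Z e W Y r W'" "\<And>j. j < e \<Longrightarrow> smooth_on W (Z j)" "i < r"
  shows "smooth_on W' (Y i)"
proof -
  have W': "open W'" "W' \<subseteq> W" "row_equiv_on W' Z e Y r"
    using assms(1) by (auto simp: step1_def)
  have comb: "smooth_combination W' Z e (Y i)"
    using W'(3) assms(3) unfolding row_equiv_on_def smooth_combination_def by blast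
  show ?thesis
    by (rule smooth_combination_imp_smooth_on[OF W'(1) _ comb])
      (rule smooth_on_subset[OF assms(2) W'(2)])
qed

text \<open>Used for the pivot columns of a reduced row echelon form, whose entries are constantly 0
  or 1.\<close>

lemma frechet_derivative_nth_zero:
  assumes "open S" "x \<in> S" "f differentiable (at x)" "\<And>y. y \<in> S \<Longrightarrow> f y $ q = c"
  shows "frechet_derivative f (at x) v $ q = 0"
proof -
  have "((\<lambda>y. f y $ q) has_derivative (\<lambda>v. frechet_derivative f (at x) v $ q)) (at x)"
    using assms(3) frechet_derivative_works
    by (intro bounded_linear.has_derivative[OF bounded_linear_vec_nth]) blast
  then show ?thesis
  proof (rule has_derivative_unique[THEN fun_cong])
    show "((\<lambda>y. f y $ q) has_derivative (\<lambda>v. 0)) (at x)"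
      by (rule has_derivative_transform_within_open[OF has_derivative_const assms(1,2) assms(4)[symmetric]])
  qed
qed

section \<open>Growth of the rank\<close>

text \<open>A vector in the span of the first \<open>r\<close> rows is determined by its pivot
  entries. A nonzero vector whose pivot entries all vanish therefore lies outside that span.\<close>

lemma dim_pivot_family:
  fixes y :: "nat \<Rightarrow> real ^ 'n"
  assumes delta: "\<And>i j. i < r \<Longrightarrow> j < r \<Longrightarrow> y i $ p j = (if i = j then 1 else 0)"
    and L: "\<And>j. j < r \<Longrightarrow> y r $ p j = 0" "y r \<noteq> 0"
  shows "dim {y j | j. j < Suc r} = Suc r"
proof -
  have split: "{y j | j. j < Suc m} = insert (y m) {y j | j. j < m}" for m
    by (auto simp: less_Suc_eq)
  have "dim {y j | j. j < m} = m" if "m \<le> r" for m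
    using that
  proof (induction m)
    case (Suc m)
    \<comment> \<open>Independence is obtained one row at a time: the rows before \<open>y m\<close>
      vanish in column \<open>p m\<close>, while \<open>y m\<close> has entry 1 there.\<close>
    have "subspace {v :: real ^ 'n. v $ p m = 0}"
      by (auto simp: subspace_def)
    moreover have "{y j | j. j < m} \<subseteq> {v. v $ p m = 0}"
      using Suc.prems delta by auto
    ultimately have "span {y j | j. j < m} \<subseteq> {v. v $ p m = 0}"
      by (rule span_minimal[rotated])
    moreover have "y m $ p m \<noteq> 0"
      using delta Suc.prems by simp
    ultimately have "y m \<notin> span {y j | j. j < m}"
      by blast
    with Suc show ?case
      by (simp add: split dim_insert)
  qed simp
  moreover have "y r \<notin> span {y j | j. j < r}"
  proof
    \<comment> \<open>The vectors reconstructed from their pivot entries form a subspace containing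
      the first \<open>r\<close> rows, hence their span.\<close>
    have "subspace {v :: real ^ 'n. v = (\<Sum>i<r. v $ p i *\<^sub>R y i)}"
      by (simp add: subspace_def scaleR_left_distrib sum.distrib flip: scaleR_scaleR scaleR_sum_right)
    moreover have "{y j | j. j < r} \<subseteq> {v. v = (\<Sum>i<r. v $ p i *\<^sub>R y i)}"
      using delta by (auto simp: if_distrib[of "\<lambda>c. c *\<^sub>R _"] cong: if_cong)
    ultimately have "span {y j | j. j < r} \<subseteq> {v. v = (\<Sum>i<r. v $ p i *\<^sub>R y i)}"
      by (rule span_minimal[rotated])
    moreover assume "y r \<in> span {y j | j. j < r}"
    ultimately have "y r = (\<Sum>i<r. y r $ p i *\<^sub>R y i)"
      by blast
    with L show False by simp
  qed
  ultimately show ?thesis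
    by (simp add: split dim_insert)
qed

lemma dim_rref_lie:
  assumes "open W" "rref_on W Y r" "\<And>i. i < r \<Longrightarrow> smooth_on W (Y i)"
    and "i < r" "j < r" "x \<in> W" "lie (Y i) (Y j) x \<noteq> 0"
  shows "dim {(Y(r := lie (Y i) (Y j))) l x | l. l < Suc r} = Suc r"
proof -
  obtain p where "\<forall>x\<in>W. \<forall>i<r. Y i x $ p i = 1 \<and> (\<forall>j<r. j \<noteq> i \<longrightarrow> Y j x $ p i = 0) \<and>
      (\<forall>k. k < p i \<longrightarrow> Y i x $ k = 0)"
    using assms(2) unfolding rref_on_def by (elim exE conjE)
  then have p: "Y j x $ p i = (if j = i then 1 else 0)" if "x \<in> W" "i < r" "j < r" for x i j
    using that by simp
  have "frechet_derivative (Y l) (at x) v $ p m = 0" if "l < r" "m < r" for l m v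
    by (rule frechet_derivative_nth_zero[OF assms(1,6)
          smooth_on_imp_differentiable[OF assms(3)[OF that(1)] assms(6)] p[OF _ that(2,1)]])
  then have "lie (Y i) (Y j) x $ p m = 0" if "m < r" for m
    using that assms(4,5) by (simp add: lie_def)
  then show ?thesis
    using p assms(6,7) by (intro dim_pivot_family[of r _ p]) simp_all
qed

text \<open>The rank clause excludes \<open>k = 0\<close>, since the initial fields may all vanish.
  Invariants are compared on subsets of the current \<open>W\<close> because the domain shrinks from
  step to step.\<close>

lemma reach_invariants:
  fixes X :: "nat \<Rightarrow> 'n::{finite,wellorder} vf"
  assumes "reach X d U k Z e W" "open U" "\<And>j. j < d \<Longrightarrow> smooth_on U (X j)"
  shows "open W \<and> (\<forall>j<e. smooth_on W (Z j)) \<and>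
    (k = 0 \<or> (\<exists>x\<in>W. Suc k \<le> dim {Z j x | j. j < e})) \<and>
    (\<forall>S f. open S \<longrightarrow> S \<subseteq> W \<longrightarrow> (joint_invariant S X d f \<longleftrightarrow> joint_invariant S Z e f))"
  using assms(1)
proof induction
  case reach_0
  then show ?case using assms(2,3) by simp
next
  case (reach_Suc k Z e W Y r W' i j)
  note step = \<open>step1 Z e W Y r W'\<close>
  let ?Y' = "Y(r := lie (Y i) (Y j))"
  have W': "open W'" "W' \<subseteq> W" "rref_on W' Y r" "row_equiv_on W' Z e Y r"
    and rank: "\<And>x. x \<in> W \<Longrightarrow> dim {Z j x | j. j < e} \<le> r"
    using step by (auto simp: step1_def)
  have smY: "smooth_on W' (Y l)" if "l < r" for l
    using step1_smooth_on[OF step] reach_Suc.IH that by blast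
  then have smY': "\<forall>l<Suc r. smooth_on W' (?Y' l)"
    using reach_Suc.hyps W'(1) by (auto simp: less_Suc_eq intro: smooth_on_lie)
  obtain x where x: "x \<in> W'" "lie (Y i) (Y j) x \<noteq> 0"
    using reach_Suc.hyps by blast
  \<comment> \<open>For \<open>k = 0\<close> the index \<open>i < r\<close> gives the bound.
    Otherwise the rank clause of \<open>step1\<close> on all of \<open>W\<close> ensures that
    passing to \<open>W'\<close> does not lose the rank attained at some point of
    \<open>W\<close>.\<close>
  have "Suc k \<le> r"
  proof (cases "k = 0")
    case True
    then show ?thesis using reach_Suc.hyps(3) by simp
  next
    case False
    then obtain x where "x \<in> W" "Suc k \<le> dim {Z j x | j. j < e}"
      using reach_Suc.IH by blast
    then show ?thesis using rank le_trans by blast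
  qed
  then have "Suc (Suc k) \<le> dim {?Y' l x | l. l < Suc r}"
    by (subst dim_rref_lie[OF W'(1,3) smY reach_Suc.hyps(3,4) x]) simp_all
  with x(1) have "\<exists>x\<in>W'. Suc (Suc k) \<le> dim {?Y' l x | l. l < Suc r}" ..
  moreover have "joint_invariant S X d f \<longleftrightarrow> joint_invariant S ?Y' (Suc r) f"
    if "open S" "S \<subseteq> W'" for S f
  proof -
    have "joint_invariant S X d f \<longleftrightarrow> joint_invariant S Y r f"
      using reach_Suc.IH that W'(2) joint_invariant_row_equiv[OF W'(4) that(2)] by blast
    \<comment> \<open>By \<open>lie_invariant\<close> the appended bracket imposes no new condition
      on \<open>f\<close>.\<close>
    also have "\<dots> \<longleftrightarrow> joint_invariant S ?Y' (Suc r) f"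
    proof
      assume inv: "joint_invariant S Y r f"
      then have "vf_apply (lie (Y i) (Y j)) f x = 0" if "x \<in> S" for x
        using that reach_Suc.hyps(3,4) smooth_on_subset[OF smY \<open>S \<subseteq> W'\<close>]
        by (intro lie_invariant[of S f "Y i" "Y j" x]) (simp_all add: joint_invariant_def)
      with inv show "joint_invariant S ?Y' (Suc r) f"
        by (auto simp: joint_invariant_def less_Suc_eq)
    next
      assume "joint_invariant S ?Y' (Suc r) f"
      then show "joint_invariant S Y r f"
        by (auto simp: joint_invariant_def less_Suc_eq split: if_splits)
    qed
    finally show ?thesis .
  qed
  ultimately show ?case using W'(1) smY' by blast
qed

text \<open>Termination is a bound on \<open>k\<close> together with the fact that Step 1 can be
  carried out from every reached state on a nonempty set. \<open>Suc k\<close> also counts the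
  iteration about to begin.\<close>

theorem theorem1p2:
  fixes X :: "nat \<Rightarrow> 'n::{finite,wellorder} vf" and d :: nat and U :: "((real, 'n) vec) set"
  assumes "open U"
    and "\<forall>j<d. smooth_on U (X j)"
  shows
    "(\<forall>k Z e W. reach X d U k Z e W \<longrightarrow> Suc k \<le> CARD('n))
     \<and> (\<forall>k Z e W. reach X d U k Z e W \<longrightarrow> W \<noteq> {} \<longrightarrow> (\<exists>Y r W'. step1 Z e W Y r W'))
     \<and> (\<forall>k Z e W V m W'. reach X d U k Z e W \<longrightarrow> step1 Z e W V m W' \<longrightarrow> commuting_on W' V m \<longrightarrow>
          (\<forall>S f. open S \<longrightarrow> S \<subseteq> W' \<longrightarrow>
             (joint_invariant S X d f \<longleftrightarrow> joint_invariant S V m f)))"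
proof (intro conjI allI impI)
  fix k Z e W
  assume "reach X d U k Z e W"
  note inv = reach_invariants[OF this assms(1) assms(2)[rule_format]]
  have "dim {Z j x | j. j < e} \<le> CARD('n)" for x
    using dim_subset_UNIV[of "{Z j x | j. j < e}"] by simp
  \<comment> \<open>Covers \<open>k = 0\<close>, where the rank clause gives nothing.\<close>
  moreover have "Suc 0 \<le> CARD('n)"
    by (simp add: Suc_le_eq)
  ultimately show "Suc k \<le> CARD('n)"
    using inv le_trans by blast
  show "\<exists>Y r W'. step1 Z e W Y r W'" if "W \<noteq> {}"
  proof -
    obtain Y r W' where "step1 Z e W Y r W'"
      by (rule step1_exists[OF _ \<open>W \<noteq> {}\<close>, of e Z]) (use inv in auto)
    then show ?thesis by blast
  qed
  fix V m W' S f
  assume step: "step1 Z e W V m W'" and S: "open S" "S \<subseteq> W'"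
  have "S \<subseteq> W" "row_equiv_on W' Z e V m"
    using step S(2) by (auto simp: step1_def)
  then show "joint_invariant S X d f \<longleftrightarrow> joint_invariant S V m f"
    using inv S(1) joint_invariant_row_equiv[OF _ S(2)] by simp
qed

end
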